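(* If $X$ is a Hausdorff space, then $nq(X)\leq L(X)$.
   Context: The Lindelöf degree $L(X)$ is the least infinite cardinal $\kappa$ such that every open cover of $X$ has a subcover of cardinality at most $\kappa$. The nonquasiregularity degree $nq(X)$ is the least infinite cardinal $\kappa$ such that for every nonempty open set $U\subseteq X$ there is a family $\mathcal{V}$ of open subsets of $X$ with $|\mathcal{V}|\leq\kappa$, such that $G=\bigcap\mathcal{V}$ is a nonempty subset of $U$ and $\bigcap_{V\in\mathcal{V}}\overline{V}\subseteq U$. Such a $\kappa$ exists whenever $X$ is Hausdorff. *)

theory Defs
  imports "HOL-Analysis.Analysis"
begin

unbundle cardinal_syntax

(* Cardinals are cardinal orders, compared by \<le>o, which may relate orders on different types.
   The value is determined up to =o; it is meaningful when some infinite cardinal satisfies P. *)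
definition least_infinite_cardinal :: "('k rel \<Rightarrow> bool) \<Rightarrow> 'k rel" where
  "least_infinite_cardinal P =
     (SOME \<kappa>. Cinfinite \<kappa> \<and> P \<kappa> \<and> (\<forall>\<mu>. Cinfinite \<mu> \<and> P \<mu> \<longrightarrow> \<kappa> \<le>o \<mu>))"

definition lindelof_bound :: "'a topology \<Rightarrow> 'k rel \<Rightarrow> bool" where
  "lindelof_bound X \<kappa> \<longleftrightarrow>
     (\<forall>\<U>. (\<forall>U\<in>\<U>. openin X U) \<and> \<Union>\<U> = topspace X \<longrightarrow>
        (\<exists>\<V>. |\<V>| \<le>o \<kappa> \<and> \<V> \<subseteq> \<U> \<and> \<Union>\<V> = topspace X))"

(* Intersecting with topspace X only matters for the empty family, whose intersection is X. *)
definition nonquasiregularity_bound :: "'a topology \<Rightarrow> 'k rel \<Rightarrow> bool" where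
  "nonquasiregularity_bound X \<kappa> \<longleftrightarrow>
     (\<forall>U. openin X U \<and> U \<noteq> {} \<longrightarrow>
        (\<exists>\<V>. |\<V>| \<le>o \<kappa> \<and> (\<forall>V\<in>\<V>. openin X V) \<and>
              topspace X \<inter> \<Inter>\<V> \<noteq> {} \<and> topspace X \<inter> \<Inter>\<V> \<subseteq> U \<and>
              topspace X \<inter> (\<Inter>V\<in>\<V>. X closure_of V) \<subseteq> U))"

(* The type 'a set + nat is infinite and large enough to index any family of subsets of X, so
   restricting the minimum to cardinal orders on it loses nothing: by the _least lemmas
   below, the values are below every admissible cardinal of every type. *)
definition lindelof_degree :: "'a topology \<Rightarrow> ('a set + nat) rel" where
  "lindelof_degree X = least_infinite_cardinal (lindelof_bound X)"

definition nonquasiregularity_degree :: "'a topology \<Rightarrow> ('a set + nat) rel" where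
  "nonquasiregularity_degree X = least_infinite_cardinal (nonquasiregularity_bound X)"

lemma least_infinite_cardinal:
  assumes "Cinfinite \<kappa>" "P \<kappa>"
  shows "Cinfinite (least_infinite_cardinal P)" "P (least_infinite_cardinal P)"
    and "\<And>\<mu>. Cinfinite \<mu> \<Longrightarrow> P \<mu> \<Longrightarrow> least_infinite_cardinal P \<le>o \<mu>"
proof -
  let ?R = "{\<mu>. Cinfinite \<mu> \<and> P \<mu>}"
  have "\<exists>r\<in>?R. \<forall>r'\<in>?R. r \<le>o r'"
    by (rule exists_minim_Card_order) (use assms in auto)
  then have "\<exists>\<kappa>. Cinfinite \<kappa> \<and> P \<kappa> \<and> (\<forall>\<mu>. Cinfinite \<mu> \<and> P \<mu> \<longrightarrow> \<kappa> \<le>o \<mu>)"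
    by blast
  from someI_ex[OF this]
  show "Cinfinite (least_infinite_cardinal P)" "P (least_infinite_cardinal P)"
    and "\<And>\<mu>. Cinfinite \<mu> \<Longrightarrow> P \<mu> \<Longrightarrow> least_infinite_cardinal P \<le>o \<mu>"
    unfolding least_infinite_cardinal_def by blast+
qed

lemma least_infinite_cardinal_le:
  "Cinfinite \<mu> \<Longrightarrow> P \<mu> \<Longrightarrow> least_infinite_cardinal P \<le>o \<mu>"
  by (rule least_infinite_cardinal(3)[where \<kappa> = \<mu>])

lemma Cinfinite_set_plus_nat: "Cinfinite |UNIV :: ('a set + nat) set|"
  using card_of_Card_order by (auto simp: cinfinite_def Field_card_of finite_Plus_UNIV_iff)

lemma card_of_family_le: "|\<V> :: 'a set set| \<le>o |UNIV :: ('a set + nat) set|"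
  by (rule card_of_ordLeqI[of Inl]) auto

lemma lindelof_bound_mono: "lindelof_bound X \<mu> \<Longrightarrow> \<mu> \<le>o \<kappa> \<Longrightarrow> lindelof_bound X \<kappa>"
  unfolding lindelof_bound_def by (meson ordLeq_transitive)

lemma nonquasiregularity_bound_mono:
  "nonquasiregularity_bound X \<mu> \<Longrightarrow> \<mu> \<le>o \<kappa> \<Longrightarrow> nonquasiregularity_bound X \<kappa>"
  unfolding nonquasiregularity_bound_def by (meson ordLeq_transitive)

lemma Cinfinite_copy:
  assumes "Cinfinite (\<mu> :: 'm rel)" "\<mu> \<le>o |UNIV :: 'k set|"
  obtains \<kappa> :: "'k rel" where "Cinfinite \<kappa>" "(\<kappa>, \<mu>) \<in> ordIso"
proof -
  have eq: "( |Field \<mu>|, \<mu>) \<in> ordIso"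
    using assms card_of_Field_ordIso by metis
  then have "|Field \<mu>| \<le>o |UNIV :: 'k set|"
    using assms(2) ordIso_ordLeq_trans by metis
  then obtain B :: "'k set" where B: "( |Field \<mu>|, |B| ) \<in> ordIso"
    using internalize_card_of_ordLeq2 by metis
  then have "(\<mu>, |B| ) \<in> ordIso"
    using eq ordIso_symmetric ordIso_transitive by metis
  then show ?thesis
    using that[of "|B|"] assms(1) Cinfinite_cong ordIso_symmetric by metis
qed

lemma lindelof_bound_UNIV: "lindelof_bound (X :: 'a topology) |UNIV :: ('a set + nat) set|"
proof -
  have "\<exists>\<V>. |\<V>| \<le>o |UNIV :: ('a set + nat) set| \<and> \<V> \<subseteq> \<U> \<and> \<Union>\<V> = topspace X"
    if "\<Union>\<U> = topspace X" for \<U>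
    using that by (intro exI[of _ \<U>] conjI card_of_family_le subset_refl)
  then show ?thesis unfolding lindelof_bound_def by simp
qed

lemma lindelof_degree:
  "Cinfinite (lindelof_degree X)" "lindelof_bound X (lindelof_degree X)"
  unfolding lindelof_degree_def
  by (rule least_infinite_cardinal[where P = "lindelof_bound X", OF Cinfinite_set_plus_nat lindelof_bound_UNIV])+

lemma lindelof_degree_least:
  fixes X :: "'a topology" and \<mu> :: "'m rel"
  assumes "Cinfinite \<mu>" "lindelof_bound X \<mu>"
  shows "lindelof_degree X \<le>o \<mu>"
proof (cases "\<mu> \<le>o |UNIV :: ('a set + nat) set|")
  case True
  then obtain \<kappa> :: "('a set + nat) rel" where \<kappa>: "Cinfinite \<kappa>" "(\<kappa>, \<mu>) \<in> ordIso"
    by (rule Cinfinite_copy[OF assms(1)])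
  then have "lindelof_bound X \<kappa>"
    using lindelof_bound_mono[OF assms(2)] ordIso_iff_ordLeq by metis
  then have "lindelof_degree X \<le>o \<kappa>"
    unfolding lindelof_degree_def using \<kappa>(1) by (intro least_infinite_cardinal_le)
  then show ?thesis using \<kappa>(2) ordLeq_ordIso_trans by metis
next
  case False
  then have "|UNIV :: ('a set + nat) set| \<le>o \<mu>"
    using assms(1) card_of_Well_order card_order_on_well_order_on ordLeq_total by metis
  moreover have "lindelof_degree X \<le>o |UNIV :: ('a set + nat) set|"
    unfolding lindelof_degree_def
    by (intro least_infinite_cardinal_le Cinfinite_set_plus_nat lindelof_bound_UNIV)
  ultimately show ?thesis using ordLeq_transitive by metis
qed

lemma nonquasiregularity_bound_UNIV:
  fixes X :: "'a topology"
  assumes "Hausdorff_space X"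
  shows "nonquasiregularity_bound X |UNIV :: ('a set + nat) set|"
  unfolding nonquasiregularity_bound_def
proof (intro allI impI, elim conjE)
  fix U assume U: "openin X U" "U \<noteq> {}"
  then obtain x where x: "x \<in> U" "x \<in> topspace X"
    using openin_subset by blast
  let ?\<V> = "{V. openin X V \<and> x \<in> V}"
  have sep: "\<exists>V\<in>?\<V>. y \<notin> X closure_of V" if "y \<in> topspace X" "y \<noteq> x" for y
  proof -
    have "\<exists>V W. openin X V \<and> openin X W \<and> x \<in> V \<and> y \<in> W \<and> disjnt V W"
      using assms[unfolded Hausdorff_space_def, rule_format, of x y] x(2) that by simp
    then obtain V W where VW: "openin X V" "openin X W" "x \<in> V" "y \<in> W" "disjnt V W"
      by (elim exE conjE)
    then have "y \<notin> X closure_of V"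
      unfolding in_closure_of disjnt_iff by blast
    with VW show ?thesis by blast
  qed
  then have cl: "topspace X \<inter> (\<Inter>V\<in>?\<V>. X closure_of V) \<subseteq> {x}"
    by blast
  moreover have "topspace X \<inter> \<Inter>?\<V> \<subseteq> topspace X \<inter> (\<Inter>V\<in>?\<V>. X closure_of V)"
  proof -
    have "V \<subseteq> X closure_of V" if "V \<in> ?\<V>" for V
      using that by (simp add: closure_of_subset openin_subset)
    then show ?thesis by blast
  qed
  moreover have "x \<in> topspace X \<inter> \<Inter>?\<V>"
    using x by blast
  ultimately show "\<exists>\<V>. |\<V>| \<le>o |UNIV :: ('a set + nat) set| \<and> (\<forall>V\<in>\<V>. openin X V) \<and>
              topspace X \<inter> \<Inter>\<V> \<noteq> {} \<and> topspace X \<inter> \<Inter>\<V> \<subseteq> U \<and>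
              topspace X \<inter> (\<Inter>V\<in>\<V>. X closure_of V) \<subseteq> U"
    using x(1) card_of_family_le by (intro exI[of _ ?\<V>] conjI) auto
qed

lemma nonquasiregularity_degree:
  assumes "Hausdorff_space X"
  shows "Cinfinite (nonquasiregularity_degree X)"
    and "nonquasiregularity_bound X (nonquasiregularity_degree X)"
  unfolding nonquasiregularity_degree_def
  by (rule least_infinite_cardinal[where P = "nonquasiregularity_bound X",
        OF Cinfinite_set_plus_nat nonquasiregularity_bound_UNIV[OF assms]])+

lemma nonquasiregularity_degree_least:
  fixes X :: "'a topology" and \<mu> :: "'m rel"
  assumes "Hausdorff_space X" "Cinfinite \<mu>" "nonquasiregularity_bound X \<mu>"
  shows "nonquasiregularity_degree X \<le>o \<mu>"
proof (cases "\<mu> \<le>o |UNIV :: ('a set + nat) set|")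
  case True
  then obtain \<kappa> :: "('a set + nat) rel" where \<kappa>: "Cinfinite \<kappa>" "(\<kappa>, \<mu>) \<in> ordIso"
    by (rule Cinfinite_copy[OF assms(2)])
  then have "nonquasiregularity_bound X \<kappa>"
    using nonquasiregularity_bound_mono[OF assms(3)] ordIso_iff_ordLeq by metis
  then have "nonquasiregularity_degree X \<le>o \<kappa>"
    unfolding nonquasiregularity_degree_def using \<kappa>(1) by (intro least_infinite_cardinal_le)
  then show ?thesis using \<kappa>(2) ordLeq_ordIso_trans by metis
next
  case False
  then have "|UNIV :: ('a set + nat) set| \<le>o \<mu>"
    using assms(2) card_of_Well_order card_order_on_well_order_on ordLeq_total by metis
  moreover have "nonquasiregularity_degree X \<le>o |UNIV :: ('a set + nat) set|"
    unfolding nonquasiregularity_degree_def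
    by (intro least_infinite_cardinal_le Cinfinite_set_plus_nat nonquasiregularity_bound_UNIV assms(1))
  ultimately show ?thesis using ordLeq_transitive by metis
qed

end

theory Submission
  imports Defs
begin

(* Fix x in the open set U. Points outside U have open neighbourhoods missing an open neighbourhood
   of x; together with U these cover X, and in a small subcover the corresponding neighbourhoods
   of x have no common closure point outside U. *)

lemma nonquasiregularity_bound_if_lindelof_bound:
  fixes X :: "'a topology"
  assumes haus: "Hausdorff_space X" and lind: "lindelof_bound X \<kappa>"
  shows "nonquasiregularity_bound X \<kappa>"
  unfolding nonquasiregularity_bound_def
proof (intro allI impI, elim conjE)
  fix U assume U: "openin X U" "U \<noteq> {}"
  then obtain x where x: "x \<in> U" "x \<in> topspace X"
    using openin_subset by blast
  \<comment> \<open>Members of \<open>\<W>\<close> are the open sets that some open neighbourhood of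
    \<open>x\<close> misses. By the Hausdorff property they cover every point other than
    \<open>x\<close>, in particular all points outside \<open>U\<close>.\<close>
  define \<W> where "\<W> = {W. openin X W \<and> (\<exists>V. openin X V \<and> x \<in> V \<and> disjnt V W)}"
  have "\<exists>W\<in>\<W>. y \<in> W" if "y \<in> topspace X" "y \<notin> U" for y
  proof -
    have "y \<noteq> x" using that x by blast
    then show ?thesis
      using haus[unfolded Hausdorff_space_def, rule_format, of x y] that x(2)
      unfolding \<W>_def by auto
  qed
  moreover have "\<forall>W\<in>insert U \<W>. openin X W"
    using U by (simp add: \<W>_def)
  moreover from this have "\<Union>(insert U \<W>) \<subseteq> topspace X"
    using openin_subset by (metis Sup_least)
  ultimately have cover: "(\<forall>W\<in>insert U \<W>. openin X W) \<and> \<Union>(insert U \<W>) = topspace X"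
    by blast
  obtain \<S> where \<S>: "|\<S>| \<le>o \<kappa>" "\<S> \<subseteq> insert U \<W>" "\<Union>\<S> = topspace X"
    using lind[unfolded lindelof_bound_def, THEN spec, THEN mp, OF cover] by (elim exE conjE)
  \<comment> \<open>\<open>U\<close> is set aside because it contains \<open>x\<close>, so no
    neighbourhood of \<open>x\<close> misses it. Choosing one neighbourhood per remaining member of
    the subcover keeps the family within \<open>\<kappa>\<close>.\<close>
  have "\<forall>W\<in>\<S> - {U}. \<exists>V. openin X V \<and> x \<in> V \<and> disjnt V W"
    using \<S>(2) by (auto simp: \<W>_def)
  then obtain f where f: "\<And>W. W \<in> \<S> - {U} \<Longrightarrow> openin X (f W) \<and> x \<in> f W \<and> disjnt (f W) W"
    by metis
  let ?\<V> = "f ` (\<S> - {U})"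
  have card: "|?\<V>| \<le>o \<kappa>"
    by (rule ordLeq_transitive[OF card_of_image ordLeq_transitive[OF card_of_mono1[OF Diff_subset] \<S>(1)]])
  have "openin X W" if "W \<in> \<S>" for W
    using that \<S>(2) cover by blast
  \<comment> \<open>\<open>W\<close> itself is an open neighbourhood of \<open>y\<close> disjoint
    from \<open>f W\<close>.\<close>
  then have miss: "y \<notin> X closure_of (f W)" if "W \<in> \<S> - {U}" "y \<in> W" for W y
    using that f[of W] unfolding in_closure_of disjnt_iff by blast
  \<comment> \<open>If \<open>\<S> = {U}\<close>, then \<open>?\<V>\<close> is empty and the left
    side is the whole space, which equals \<open>U\<close> since \<open>\<S>\<close> covers.\<close>
  have cl: "topspace X \<inter> (\<Inter>V\<in>?\<V>. X closure_of V) \<subseteq> U"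
  proof
    fix y assume y: "y \<in> topspace X \<inter> (\<Inter>V\<in>?\<V>. X closure_of V)"
    then obtain W where W: "W \<in> \<S>" "y \<in> W"
      using \<S>(3) by (metis IntD1 UnionE)
    \<comment> \<open>Otherwise \<open>miss\<close> puts \<open>y\<close> outside the closure of
      \<open>f W\<close>. So the member covering \<open>y\<close> can only be
      \<open>U\<close>.\<close>
    have "W \<notin> \<S> - {U}"
      using miss[of W y] W(2) y by (auto simp only: INT_iff Int_iff image_iff)
    with W show "y \<in> U" by simp
  qed
  have "V \<subseteq> X closure_of V" if "V \<in> ?\<V>" for V
    using that f by (auto intro!: closure_of_subset openin_subset)
  then have "topspace X \<inter> \<Inter>?\<V> \<subseteq> topspace X \<inter> (\<Inter>V\<in>?\<V>. X closure_of V)"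
    by blast
  then have "topspace X \<inter> \<Inter>?\<V> \<subseteq> U"
    using cl by (rule subset_trans)
  moreover have "x \<in> topspace X \<inter> \<Inter>?\<V>"
    using x f by blast
  then have "topspace X \<inter> \<Inter>?\<V> \<noteq> {}"
    by (metis empty_iff)
  moreover have "\<forall>V\<in>?\<V>. openin X V"
    using f by blast
  ultimately show "\<exists>\<V>. |\<V>| \<le>o \<kappa> \<and> (\<forall>V\<in>\<V>. openin X V) \<and>
              topspace X \<inter> \<Inter>\<V> \<noteq> {} \<and> topspace X \<inter> \<Inter>\<V> \<subseteq> U \<and>
              topspace X \<inter> (\<Inter>V\<in>\<V>. X closure_of V) \<subseteq> U"
    using cl card by (intro exI[of _ ?\<V>] conjI)
qed

theorem proposition2p12:
  fixes X :: "'a topology"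
  assumes "Hausdorff_space X"
  shows "nonquasiregularity_degree X \<le>o lindelof_degree X"
  \<comment> \<open>Here \<open>\<kappa>\<close> is the Lindelof degree itself, an infinite cardinal
    that is a Lindelof bound; leastness of the nonquasiregularity degree concludes.\<close>
  by (intro nonquasiregularity_degree_least nonquasiregularity_bound_if_lindelof_bound
      lindelof_degree assms)

end
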